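(* Let $G$ be a simple graph with $n$ vertices and $m$ edges. Let $h(G)$ be the number of $3$-element subsets $S\subseteq V(G)$ such that the induced subgraph $G[S]$ has exactly one edge (i.e. the number of induced copies in $G$ of the graph on three vertices with one edge). Then the number of triangles in $G$ is at least $$\frac{h(G)}{3}+\frac{4m}{3n}\left(m-\frac{n^2}{4}\right).$$
   Context: A graph is simple if it has no loops or parallel edges. A triangle is a set of three pairwise adjacent vertices. *)

theory Defs
  imports Complex_Main "HOL-Library.Ramsey"
begin

text \<open>
  An edge is a two-element set of vertices, which rules out loops and parallel edges;
  \<open>[V]\<^bsup>k\<^esup>\<close> is the set of \<open>k\<close>-element subsets of \<open>V\<close>.
\<close>

definition simple_graph :: "'a set \<Rightarrow> 'a set set \<Rightarrow> bool" where
  "simple_graph V E \<longleftrightarrow> finite V \<and> E \<subseteq> [V]\<^bsup>2\<^esup>"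

definition induced_edges :: "'a set set \<Rightarrow> 'a set \<Rightarrow> 'a set set" where
  "induced_edges E S = {e \<in> E. e \<subseteq> S}"

definition one_edge_triples :: "'a set \<Rightarrow> 'a set set \<Rightarrow> 'a set set" where
  "one_edge_triples V E = {S \<in> [V]\<^bsup>3\<^esup>. card (induced_edges E S) = 1}"

definition triangles :: "'a set \<Rightarrow> 'a set set \<Rightarrow> 'a set set" where
  "triangles V E = {T \<in> [V]\<^bsup>3\<^esup>. clique T E}"

end

theory Submission
  imports Defs "HOL-Analysis.Convex"
begin

text \<open>
  Write \<open>i(S)\<close> for the number of edges inside a triple \<open>S\<close>. As \<open>i(S) \<le> 3\<close>, the integer
  \<open>i(S)\<^sup>2 - 2 i(S)\<close> is 3 on triangles, -1 on triples with exactly one edge and 0 otherwise.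
  Summing over all triples and counting pairs of edges instead gives
  \<open>3 t - h = (\<Sum>v. d(v)\<^sup>2) - m n\<close>, where \<open>d\<close> is the degree, and by Cauchy--Schwarz
  \<open>n (\<Sum>v. d(v)\<^sup>2) \<ge> (\<Sum>v. d(v))\<^sup>2 = (2 m)\<^sup>2\<close>.
\<close>

text \<open>Every double count below is an instance of this exchange, with incidence or containment
  as the relation \<open>R\<close>.\<close>

lemma sum_card_Collect_swap:
  assumes "finite A" "finite B"
  shows "(\<Sum>a\<in>A. card {b \<in> B. R a b}) = (\<Sum>b\<in>B. card {a \<in> A. R a b})"
  using sum.swap_restrict[OF assms, of "\<lambda>_ _. 1::nat" R] by simp

lemma clique_iff_nsets_subset: "clique T E \<longleftrightarrow> [T]\<^bsup>2\<^esup> \<subseteq> E"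
  unfolding clique_def nsets_2_eq by auto

lemma induced_edges_eq:
  assumes "simple_graph V E"
  shows "induced_edges E S = E \<inter> [S]\<^bsup>2\<^esup>"
  using assms by (auto simp: simple_graph_def induced_edges_def nsets_def)

lemma finite_edges: "simple_graph V E \<Longrightarrow> finite E"
  unfolding simple_graph_def by (meson finite_imp_finite_nsets finite_subset)

lemma triple_edge_weight:
  assumes G: "simple_graph V E" and S: "S \<in> [V]\<^bsup>3\<^esup>"
  shows "(int (card (induced_edges E S)))\<^sup>2 - 2 * int (card (induced_edges E S)) =
    3 * of_bool (clique S E) - of_bool (card (induced_edges E S) = 1)"
proof -
  have fin: "finite S" and "card S = 3"
    using S by (auto simp: nsets_def)
  then have c: "card ([S]\<^bsup>2\<^esup>) = 3"
    by (simp add: choose_two)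
  have fin2: "finite ([S]\<^bsup>2\<^esup>)"
    using fin by (simp add: finite_imp_finite_nsets)
  have le: "card (E \<inter> [S]\<^bsup>2\<^esup>) \<le> 3"
    using c card_mono[OF fin2, of "E \<inter> [S]\<^bsup>2\<^esup>"] by simp
  \<comment> \<open>A triple has three pairs, so all of them are edges exactly when the count
    reaches 3. The values 0, 1, 2, 3 of the count then give the weights 0, -1, 0, 3.\<close>
  have "clique S E \<longleftrightarrow> card (E \<inter> [S]\<^bsup>2\<^esup>) = 3"
    unfolding clique_iff_nsets_subset
    using c card_subset_eq[OF fin2, of "E \<inter> [S]\<^bsup>2\<^esup>"] by (auto simp: Int_absorb1)
  moreover have "card (E \<inter> [S]\<^bsup>2\<^esup>) \<in> {0, 1, 2, 3}"
    using le by auto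
  ultimately show ?thesis
    unfolding induced_edges_eq[OF G] by auto
qed

lemma sum_triple_edge_weight:
  assumes G: "simple_graph V E"
  shows "(\<Sum>S\<in>[V]\<^bsup>3\<^esup>. (int (card (induced_edges E S)))\<^sup>2 - 2 * int (card (induced_edges E S))) =
    3 * int (card (triangles V E)) - int (card (one_edge_triples V E))"
proof -
  have "finite ([V]\<^bsup>3\<^esup>)"
    using G by (simp add: simple_graph_def finite_imp_finite_nsets)
  then show ?thesis
    by (simp add: triple_edge_weight[OF G] sum_subtractf flip: sum_distrib_left)
      (simp add: triangles_def one_edge_triples_def Int_def)
qed

text \<open>Such a triple arises from \<open>e\<close> by adding a third vertex, which may be any
  element of \<open>V - e\<close> and is determined by the triple.\<close>

lemma card_triples_containing_pair:
  assumes "finite V" "e \<in> [V]\<^bsup>2\<^esup>"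
  shows "card {S \<in> [V]\<^bsup>3\<^esup>. e \<subseteq> S} = card V - 2"
proof -
  have e: "finite e" "card e = 2" "e \<subseteq> V"
    using assms by (auto simp: nsets_def)
  have "{S \<in> [V]\<^bsup>3\<^esup>. e \<subseteq> S} = (\<lambda>w. insert w e) ` (V - e)"
  proof (intro equalityI subsetI)
    fix S assume "S \<in> {S \<in> [V]\<^bsup>3\<^esup>. e \<subseteq> S}"
    then have S: "S \<subseteq> V" "card S = 3" "finite S" "e \<subseteq> S"
      by (auto simp: nsets_def)
    then have "card (S - e) = 1"
      using e by (simp add: card_Diff_subset)
    then obtain w where w: "S - e = {w}"
      by (auto simp: card_1_singleton_iff)
    then have "S = insert w e" "w \<in> V - e"
      using S by auto
    then show "S \<in> (\<lambda>w. insert w e) ` (V - e)"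
      by blast
  qed (use e in \<open>auto simp: nsets_def\<close>)
  moreover have "inj_on (\<lambda>w. insert w e) (V - e)"
    by (auto simp: inj_on_def)
  ultimately show ?thesis
    using e by (simp add: card_image card_Diff_subset)
qed

text \<open>Disjoint pairs fit in no triple, and pairs sharing one vertex fit only in their union,
  so for distinct pairs the count is \<open>card (e \<inter> f)\<close>. For equal pairs this term
  is 2 and the true count is n - 2, hence the correction n - 4. It is negative for n = 2 and n = 3,
  so the statement is over the integers.\<close>

lemma card_triples_containing_two_pairs:
  assumes V: "finite V" and e: "e \<in> [V]\<^bsup>2\<^esup>" and f: "f \<in> [V]\<^bsup>2\<^esup>"
  shows "int (card {S \<in> [V]\<^bsup>3\<^esup>. e \<subseteq> S \<and> f \<subseteq> S}) =
    int (card (e \<inter> f)) + (if e = f then int (card V) - 4 else 0)"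
proof (cases "e = f")
  case True
  moreover have "card e = 2" "card V \<ge> 2"
    using e V card_mono[of V e] by (auto simp: nsets_def)
  ultimately show ?thesis
    using card_triples_containing_pair[OF V e] by simp
next
  case False
  have fin: "finite e" "finite f" "card e = 2" "card f = 2" "e \<subseteq> V" "f \<subseteq> V"
    using e f by (auto simp: nsets_def)
  have un: "card (e \<union> f) + card (e \<inter> f) = 4"
    using card_Un_Int[of e f] fin by simp
  have "card (e \<inter> f) \<noteq> 2"
    using False fin by (metis card_subset_eq inf.cobounded1 inf.cobounded2)
  moreover have "card (e \<inter> f) \<le> 2"
    using card_mono[of e "e \<inter> f"] fin by simp
  ultimately consider "card (e \<inter> f) = 0" | "card (e \<inter> f) = 1"
    by linarith
  then show ?thesis
  proof cases
    case 1
    have "\<not> (S \<in> [V]\<^bsup>3\<^esup> \<and> e \<subseteq> S \<and> f \<subseteq> S)" for S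
      using card_mono[of S "e \<union> f"] un 1 by (auto simp: nsets_def)
    then have "{S \<in> [V]\<^bsup>3\<^esup>. e \<subseteq> S \<and> f \<subseteq> S} = {}"
      by blast
    then show ?thesis
      using 1 False by (simp only: card.empty) simp
  next
    case 2
    have "S = e \<union> f" if "S \<in> [V]\<^bsup>3\<^esup>" "e \<subseteq> S" "f \<subseteq> S" for S
      using card_subset_eq[of S "e \<union> f"] un 2 that by (auto simp: nsets_def)
    moreover have "e \<union> f \<in> [V]\<^bsup>3\<^esup>"
      using un 2 fin by (auto simp: nsets_def)
    ultimately have "{S \<in> [V]\<^bsup>3\<^esup>. e \<subseteq> S \<and> f \<subseteq> S} = {e \<union> f}"
      by blast
    then show ?thesis
      using 2 False by (simp only: card.empty card.insert) simp
  qed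
qed

lemma sum_card_induced_edges:
  assumes G: "simple_graph V E"
  shows "(\<Sum>S\<in>[V]\<^bsup>3\<^esup>. card (induced_edges E S)) = card E * (card V - 2)"
proof -
  have V: "finite V" "E \<subseteq> [V]\<^bsup>2\<^esup>"
    using G by (auto simp: simple_graph_def)
  have "(\<Sum>S\<in>[V]\<^bsup>3\<^esup>. card (induced_edges E S)) = (\<Sum>e\<in>E. card {S \<in> [V]\<^bsup>3\<^esup>. e \<subseteq> S})"
    unfolding induced_edges_def
    by (rule sum_card_Collect_swap) (use V finite_edges[OF G] in \<open>auto intro: finite_imp_finite_nsets\<close>)
  also have "\<dots> = (\<Sum>e\<in>E. card V - 2)"
    using V by (intro sum.cong refl card_triples_containing_pair) auto
  finally show ?thesis
    by simp
qed

text \<open>Both sides count ordered pairs of edges, equal ones included, together with a common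
  vertex.\<close>

lemma sum_card_Int_edges:
  assumes G: "simple_graph V E"
  shows "(\<Sum>(e, f)\<in>E \<times> E. card (e \<inter> f)) = (\<Sum>v\<in>V. (card {e \<in> E. v \<in> e})\<^sup>2)"
proof -
  have V: "finite V" and sub: "\<And>e. e \<in> E \<Longrightarrow> e \<subseteq> V"
    using G by (auto simp: simple_graph_def nsets_def)
  have "(\<Sum>(e, f)\<in>E \<times> E. card (e \<inter> f)) =
      (\<Sum>p\<in>E \<times> E. card {v \<in> V. v \<in> fst p \<and> v \<in> snd p})"
    using sub by (intro sum.cong) (auto intro!: arg_cong[where f = card])
  also have "\<dots> = (\<Sum>v\<in>V. card {p \<in> E \<times> E. v \<in> fst p \<and> v \<in> snd p})"
    by (rule sum_card_Collect_swap) (use V finite_edges[OF G] in auto)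
  also have "\<dots> = (\<Sum>v\<in>V. card ({e \<in> E. v \<in> e} \<times> {e \<in> E. v \<in> e}))"
    by (intro sum.cong refl arg_cong[where f = card]) auto
  finally show ?thesis
    by (simp add: card_cartesian_product power2_eq_square)
qed

text \<open>The square counts ordered pairs of edges inside \<open>S\<close>. Exchanging the sums
  leaves, for each pair of edges, the number of triples containing both; the overlaps add up to the
  squared degrees and the m equal pairs add n - 4 each.\<close>

lemma sum_card_induced_edges_square:
  assumes G: "simple_graph V E"
  shows "(\<Sum>S\<in>[V]\<^bsup>3\<^esup>. (int (card (induced_edges E S)))\<^sup>2) =
    (\<Sum>v\<in>V. (int (card {e \<in> E. v \<in> e}))\<^sup>2) + int (card E) * (int (card V) - 4)"
proof -
  have V: "finite V" "E \<subseteq> [V]\<^bsup>2\<^esup>" and E: "finite E"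
    using G finite_edges[OF G] by (auto simp: simple_graph_def)
  have "(\<Sum>S\<in>[V]\<^bsup>3\<^esup>. (card (induced_edges E S))\<^sup>2) =
      (\<Sum>S\<in>[V]\<^bsup>3\<^esup>. card {p \<in> E \<times> E. fst p \<subseteq> S \<and> snd p \<subseteq> S})"
  proof (rule sum.cong[OF refl])
    fix S
    have "{p \<in> E \<times> E. fst p \<subseteq> S \<and> snd p \<subseteq> S} = induced_edges E S \<times> induced_edges E S"
      by (auto simp: induced_edges_def)
    then show "(card (induced_edges E S))\<^sup>2 = card {p \<in> E \<times> E. fst p \<subseteq> S \<and> snd p \<subseteq> S}"
      by (simp add: card_cartesian_product power2_eq_square)
  qed
  also have "\<dots> = (\<Sum>p\<in>E \<times> E. card {S \<in> [V]\<^bsup>3\<^esup>. fst p \<subseteq> S \<and> snd p \<subseteq> S})"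
    by (rule sum_card_Collect_swap) (use V E in \<open>auto intro: finite_imp_finite_nsets\<close>)
  finally have "(\<Sum>S\<in>[V]\<^bsup>3\<^esup>. (int (card (induced_edges E S)))\<^sup>2) =
      (\<Sum>p\<in>E \<times> E. int (card {S \<in> [V]\<^bsup>3\<^esup>. fst p \<subseteq> S \<and> snd p \<subseteq> S}))"
    by (simp flip: of_nat_power of_nat_sum)
  also have "\<dots> = (\<Sum>p\<in>E \<times> E. int (card (fst p \<inter> snd p)) +
      (if fst p = snd p then int (card V) - 4 else 0))"
    using V by (intro sum.cong refl card_triples_containing_two_pairs) auto
  \<comment> \<open>As a nested sum, the correction collapses to the single term
    \<open>f = e\<close> for each \<open>e\<close>.\<close>
  also have "\<dots> = int (\<Sum>(e, f)\<in>E \<times> E. card (e \<inter> f)) +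
      (\<Sum>e\<in>E. \<Sum>f\<in>E. if e = f then int (card V) - 4 else 0)"
    by (simp add: sum.distrib sum.cartesian_product case_prod_beta)
  finally show ?thesis
    using E by (simp add: sum_card_Int_edges[OF G])
qed

text \<open>The linear terms combine: m (n - 4) - 2 m (n - 2) = - m n.\<close>

lemma triangles_minus_one_edge_triples:
  assumes G: "simple_graph V E"
  shows "3 * int (card (triangles V E)) - int (card (one_edge_triples V E)) =
    (\<Sum>v\<in>V. (int (card {e \<in> E. v \<in> e}))\<^sup>2) - int (card E) * int (card V)"
proof -
  \<comment> \<open>Natural subtraction truncates when n < 2, but then there are no edges and both
    sides vanish.\<close>
  have "int (card E) * int (card V - 2) = int (card E) * (int (card V) - 2)"
  proof (cases "E = {}")
    case False
    then obtain e where "e \<in> [V]\<^bsup>2\<^esup>" and V: "finite V"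
      using G by (auto simp: simple_graph_def)
    then have "card V \<ge> 2"
      using card_mono[of V e] by (auto simp: nsets_def)
    then show ?thesis by simp
  qed simp
  then have "(\<Sum>S\<in>[V]\<^bsup>3\<^esup>. int (card (induced_edges E S))) = int (card E) * (int (card V) - 2)"
    using sum_card_induced_edges[OF G] by (simp flip: of_nat_sum)
  then show ?thesis
    unfolding sum_triple_edge_weight[OF G, symmetric]
    by (simp add: sum_subtractf sum_card_induced_edges_square[OF G] algebra_simps
        flip: sum_distrib_left)
qed

lemma handshake:
  assumes G: "simple_graph V E"
  shows "(\<Sum>v\<in>V. card {e \<in> E. v \<in> e}) = 2 * card E"
proof -
  have V: "finite V" and sub: "\<And>e. e \<in> E \<Longrightarrow> e \<subseteq> V \<and> card e = 2"
    using G by (auto simp: simple_graph_def nsets_def)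
  have "(\<Sum>v\<in>V. card {e \<in> E. v \<in> e}) = (\<Sum>e\<in>E. card {v \<in> V. v \<in> e})"
    by (rule sum_card_Collect_swap[OF V finite_edges[OF G]])
  also have "\<dots> = (\<Sum>e\<in>E. 2)"
  proof (rule sum.cong[OF refl])
    fix e assume "e \<in> E"
    then have "{v \<in> V. v \<in> e} = e" "card e = 2"
      using sub by auto
    then show "card {v \<in> V. v \<in> e} = 2"
      by simp
  qed
  finally show ?thesis by simp
qed

theorem theorem2p3:
  fixes V :: "'a set" and E :: "'a set set" and n m :: nat
  assumes "simple_graph V E"
    and "card V = n"
    and "card E = m"
  shows "real (card (triangles V E)) \<ge>
    real (card (one_edge_triples V E)) / 3
      + 4 * real m / (3 * real n) * (real m - (real n)\<^sup>2 / 4)"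
proof -
  let ?d = "\<lambda>v. card {e \<in> E. v \<in> e}"
  let ?t = "real (card (triangles V E))" and ?h = "real (card (one_edge_triples V E))"
  have "(\<Sum>v\<in>V. real (?d v)) = 2 * real m"
    using handshake[OF assms(1)] assms(3) by (simp flip: of_nat_sum)
  then have CS: "(2 * real m)\<^sup>2 \<le> (\<Sum>v\<in>V. (real (?d v))\<^sup>2) * real n"
    using sum_squared_le_sum_of_squares[of "\<lambda>v. real (?d v)" V] assms(2) by simp
  have "real_of_int (3 * int (card (triangles V E)) - int (card (one_edge_triples V E))) =
      real_of_int ((\<Sum>v\<in>V. (int (?d v))\<^sup>2) - int (card E) * int (card V))"
    by (simp only: triangles_minus_one_edge_triples[OF assms(1)])
  then have id: "3 * ?t - ?h = (\<Sum>v\<in>V. (real (?d v))\<^sup>2) - real m * real n"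
    using assms by simp
  show ?thesis
  proof (cases "n = 0")
    case True
    \<comment> \<open>Division by zero makes the second summand vanish, and there are no vertices.\<close>
    then show ?thesis
      using assms id by (simp add: simple_graph_def)
  next
    case False
    then have "(2 * real m)\<^sup>2 / real n \<le> 3 * ?t - ?h + real m * real n"
      using CS id by (simp add: divide_le_eq)
    \<comment> \<open>In this form the second summand is a third of the lower bound 4 m^2 / n - m n
      for 3 t - h, so dividing by 3 finishes the proof.\<close>
    moreover have "4 * real m / (3 * real n) * (real m - (real n)\<^sup>2 / 4) =
        ((2 * real m)\<^sup>2 / real n - real m * real n) / 3"
      using False by (simp add: field_simps power2_eq_square)
    ultimately show ?thesis
      by (simp add: field_simps)
  qed
qed

end
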